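(* Let $p\in(0,p_0)$. Let $\varepsilon_0:=\varepsilon_1-\varepsilon_2>0$ and let $\delta:=\varepsilon_0/2$. Fix $0<\eta<c_1$ and let $b=b(\eta)>0$ be such that, for every $n\in\mathbb{N}$ large enough, $\inf_{k\in\mathbb{Z}:\,|k-2nq|<bn}\mathbb{P}(U_n=k)\geq e^{-\eta n}$. Let $t_0>0$ be the unique positive solution $t$ to $$2\delta t-b^2-2\ln M_q(\delta t)=0.$$ Then, for any $\epsilon>0$ and any $t\in[0,t_0]$, there exists $N(t)\in\mathbb{N}$ such that for any $n\geq N(t)$, $$\mathbb{E}\left(e^{t\left(L_n(\mathbf{Z}_n)-\ell_n(2nq)\right)}\right)\geq(1-\epsilon)\,M_q^{2n}(\delta t).$$
   Context: Binary LCS setting: $\mathbf{X}_n=(X_1,\ldots,X_n)$ and $\mathbf{Y}_n=(Y_1,\ldots,Y_n)$ are independent sequences of i.i.d. $\{0,1\}$-valued random variables with $\mathbb{P}(X_1=1)=\mathbb{P}(Y_1=1)=p\in(0,1)$, $q=1-p$, $\mathbf{Z}_n=(\mathbf{X}_n,\mathbf{Y}_n)$, and $L_n=L_n(\mathbf{Z}_n)$ is the length of the longest common subsequences of $\mathbf{X}_n$ and $\mathbf{Y}_n$. $U_n$ is the number of zeros in $\mathbf{Z}_n$, so $U_n\sim B(2n,q)$, and $\ell_n(u):=\mathbb{E}(L_n(\mathbf{Z}_n)\,|\,U_n=u)$ for $u\in\{0,\ldots,2n\}$. When $2nq$ is not an integer, $\ell_n(2nq)$ is read as $\ell_n(\lceil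 2nq\rceil)$. $M_q(t):=e^{t(1-q)}q+e^{-tq}(1-q)$, and $M_q^{2n}(\delta t)=(M_q(\delta t))^{2n}$. The constants $p_0,\varepsilon_1,\varepsilon_2,c_1$: given $\mathbf{Z}_n$, let $\widetilde{\mathbf{Z}}_n$ be obtained by choosing uniformly at random one of the ones in $\mathbf{Z}_n$ and turning it into a zero. By a known theorem (Lember–Matzinger), there exist constants $\varepsilon_1>\varepsilon_2>0$ and sets $B_n\subseteq\{0,1\}^n\times\{0,1\}^n$ such that for every $\mathbf{z}_n\in B_n$, $\mathbb{P}(L_n(\widetilde{\mathbf{Z}}_n)-L_n(\mathbf{Z}_n)=1\,|\,\mathbf{Z}_n=\mathbf{z}_n)\geq\varepsilon_1$ and $\mathbb{P}(L_n(\widetilde{\mathbf{Z}}_n)-L_n(\mathbf{Z}_n)=-1\,|\,\mathbf{Z}_n=\mathbf{z}_n)\leq\varepsilon_2$; moreover there exists $p_0>0$ such that for every $0<p<p_0$, $\mathbb{P}(\mathbf{Z}_n\in B_n)\geq 1-e^{-c_1n}$ for all large $n$, where $c_1>0$ does not depend on $n$ (but may depend on $p$). Fix such $p_0,\varepsilon_1,\varepsilon_2,c_1$; this theorem may be taken as given. A constant $b(\eta)$ as in the claim exists for every $\eta>0$. *)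

theory Defs
  imports "HOL-Probability.Probability" "HOL-Library.Sublist"
begin

(* A realization of Z_n is a pair of bool lists of length n; True stands for the letter 1 and
   False for the letter 0. *)
type_synonym word_pair = "bool list \<times> bool list"

(* Maximal length of a (not necessarily contiguous) common subsequence. *)
definition lcs :: "word_pair \<Rightarrow> nat" where
  "lcs z = Max {length s | s. subseq s (fst z) \<and> subseq s (snd z)}"

definition zeros :: "word_pair \<Rightarrow> nat" where
  "zeros z = count_list (fst z) False + count_list (snd z) False"

(* The law of Z_n = (X_n, Y_n): all 2n letters are independent and equal to 1 with probability p. *)
definition Z_law :: "real \<Rightarrow> nat \<Rightarrow> word_pair pmf" where
  "Z_law p n = pair_pmf (replicate_pmf n (bernoulli_pmf p)) (replicate_pmf n (bernoulli_pmf p))"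

(* E(L_n | U_n = u). For 0 < p < 1 the conditioning event has positive probability exactly when
   u \<le> 2n, and cond_pmf is unspecified otherwise. *)
definition ell :: "real \<Rightarrow> nat \<Rightarrow> nat \<Rightarrow> real" where
  "ell p n u = measure_pmf.expectation (cond_pmf (Z_law p n) {z. zeros z = u}) (\<lambda>z. real (lcs z))"

(* Positions of the ones: Inl i refers to the first word, Inr i to the second. *)
definition one_positions :: "word_pair \<Rightarrow> (nat + nat) set" where
  "one_positions z =
     {i. i < length (fst z) \<and> fst z ! i} <+> {i. i < length (snd z) \<and> snd z ! i}"

fun set_zero :: "word_pair \<Rightarrow> nat + nat \<Rightarrow> word_pair" where
  "set_zero (x, y) (Inl i) = (x[i := False], y)"
| "set_zero (x, y) (Inr i) = (x, y[i := False])"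

(* Conditional law of the modified pair given Z_n = z: a uniformly chosen one is turned into a
   zero. If z contains no one, nothing is changed. *)
definition Z_tilde :: "word_pair \<Rightarrow> word_pair pmf" where
  "Z_tilde z = (if one_positions z = {} then return_pmf z
                else map_pmf (set_zero z) (pmf_of_set (one_positions z)))"

(* The defining property of the constants in the Lember-Matzinger theorem. The sets B n and the
   constants eps1, eps2 do not depend on p, whereas the rate c1 may. *)
definition Lember_Matzinger :: "real \<Rightarrow> real \<Rightarrow> real \<Rightarrow> (real \<Rightarrow> real) \<Rightarrow> bool" where
  "Lember_Matzinger p0 eps1 eps2 c1 \<longleftrightarrow>
     0 < p0 \<and> 0 < eps2 \<and> eps2 < eps1 \<and>
     (\<exists>B :: nat \<Rightarrow> word_pair set.
        (\<forall>n. B n \<subseteq> {x. length x = n} \<times> {y. length y = n}) \<and>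
        (\<forall>n. \<forall>z \<in> B n.
           measure_pmf.prob (Z_tilde z) {z'. int (lcs z') - int (lcs z) = 1} \<ge> eps1 \<and>
           measure_pmf.prob (Z_tilde z) {z'. int (lcs z') - int (lcs z) = - 1} \<le> eps2) \<and>
        (\<forall>p. 0 < p \<and> p < 1 \<and> p < p0 \<longrightarrow>
           0 < c1 p \<and>
           (\<forall>\<^sub>F n in sequentially.
              measure_pmf.prob (Z_law p n) (B n) \<ge> 1 - exp (- c1 p * real n))))"

(* M_q, the moment generating function of a centred Bernoulli(q) variable. *)
definition mgf :: "real \<Rightarrow> real \<Rightarrow> real" where
  "mgf q t = exp (t * (1 - q)) * q + exp (- t * q) * (1 - q)"

end

theory Submission
  imports Defs "HOL-Real_Asymp.Real_Asymp"
begin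

text \<open>
  Turning a uniformly chosen one of \<open>Z\<^sub>n\<close> conditioned on \<open>U\<^sub>n = u\<close> into a zero gives \<open>Z\<^sub>n\<close>
  conditioned on \<open>U\<^sub>n = u + 1\<close>, so \<open>ell (u + 1) - ell u\<close> is the conditional mean of the change of
  \<open>L\<^sub>n\<close>. On \<open>B\<^sub>n\<close> this change has mean at least \<open>eps0\<close>, elsewhere at least \<open>- 1\<close>, and for
  \<open>\<bar>u - 2nq\<bar> < bn\<close> the complement of \<open>B\<^sub>n\<close> has conditional probability at most
  \<open>exp (- (c1 - \<eta>) n)\<close>. Hence \<open>ell\<close> eventually grows with slope at least \<open>3/2 \<delta>\<close> there; the spare
  \<open>\<delta>/2\<close> absorbs the rounding of \<open>2nq\<close>.

  By Jensen's inequality conditionally on \<open>U\<^sub>n\<close>, the moment in question dominates the part of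
  \<open>E exp (\<delta>t (U\<^sub>n - 2nq)) = M\<^sub>q(\<delta>t)\<^sup>2\<^sup>n\<close> with \<open>\<lceil>2nq\<rceil> + 2 \<le> U\<^sub>n < 2nq + bn\<close>. What lies below is bounded by
  a constant, while \<open>M\<^sub>q(\<delta>t) > 1\<close> for \<open>t > 0\<close>. What lies above is at most
  \<open>exp (2n\<delta>tp - b\<^sup>2n)\<close> by Hoeffding's lemma, which for \<open>t \<le> t\<^sub>0\<close> is at most
  \<open>exp (- 2n\<delta>tq)\<close> times \<open>M\<^sub>q(\<delta>t)\<^sup>2\<^sup>n\<close>.
\<close>

section \<open>Changing one letter\<close>

text \<open>Split \<open>s\<close> after the part matched inside \<open>u\<close>. Dropping the
  first letter of the remainder frees the position of \<open>c\<close>, whether or not that letter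
  was matched there, and what is left embeds in \<open>v\<close>.\<close>

lemma subseq_replace_letter:
  assumes "subseq s (u @ c # v)"
  obtains s' where "subseq s' s" "subseq s' (u @ d # v)" "length s \<le> Suc (length s')"
proof -
  obtain s1 s2 where s: "s = s1 @ s2" "subseq s1 u" "subseq s2 (c # v)"
    using assms by (auto simp: subseq_append_iff)
  obtain s3 where s3: "subseq s3 s2" "subseq s3 v" "length s2 \<le> Suc (length s3)"
  proof (cases s2)
    case Nil
    then show ?thesis using that[of "[]"] by simp
  next
    case (Cons a w)
    then have "subseq w v"
      using s(3) by (auto split: if_splits dest: subseq_Cons')
    then show ?thesis using that[of w] Cons by auto
  qed
  have "subseq (s1 @ s3) s" "subseq (s1 @ s3) (u @ d # v)"
    using s s3 by (auto intro!: list_emb_append_mono)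
  with that s s3 show thesis by auto
qed

definition common_subseq_lengths :: "word_pair \<Rightarrow> nat set" where
  "common_subseq_lengths z = {length s |s. subseq s (fst z) \<and> subseq s (snd z)}"

lemma finite_common_subseq_lengths: "finite (common_subseq_lengths z)"
  unfolding common_subseq_lengths_def
  by (rule finite_subset[of _ "{..length (fst z)}"]) (auto dest: list_emb_length)

lemma lcs_attained:
  obtains s where "subseq s (fst z)" "subseq s (snd z)" "length s = lcs z"
proof -
  have "common_subseq_lengths z \<noteq> {}"
    unfolding common_subseq_lengths_def by (auto intro: exI[of _ "[]"])
  then have "lcs z \<in> common_subseq_lengths z"
    using Max_in[OF finite_common_subseq_lengths] by (simp add: lcs_def common_subseq_lengths_def)
  with that show thesis by (auto simp: common_subseq_lengths_def)
qed

lemma length_le_lcs: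
  assumes "subseq s (fst z)" "subseq s (snd z)"
  shows "length s \<le> lcs z"
  using Max_ge[OF finite_common_subseq_lengths, of "length s" z] assms
  by (auto simp: lcs_def common_subseq_lengths_def)

lemma lcs_commute: "lcs (x, y) = lcs (y, x)"
  by (simp add: lcs_def conj_commute)

text \<open>A longest common subsequence loses at most one letter through the change in
  \<open>x\<close> and, being merely shortened, still embeds in \<open>y\<close>. An index out of
  range changes nothing.\<close>

lemma lcs_update_fst: "lcs (x, y) \<le> Suc (lcs (x[i := d], y))"
proof (cases "i < length x")
  case True
  obtain s where s: "subseq s x" "subseq s y" "length s = lcs (x, y)"
    using lcs_attained[of "(x, y)"] by auto
  obtain s' where "subseq s' s" "subseq s' (x[i := d])" "length s \<le> Suc (length s')"
    using subseq_replace_letter[of s "take i x" "x ! i" "drop (Suc i) x" d] s True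
    by (auto simp: upd_conv_take_nth_drop id_take_nth_drop[symmetric])
  moreover from this have "subseq s' y"
    using s(2) subseq_order.order_trans by blast
  ultimately show ?thesis
    using length_le_lcs[of s' "(x[i := d], y)"] s(3) by auto
qed (simp add: list_update_beyond)

text \<open>Since a flip never costs more than one, the probability of the change \<open>- 1\<close>
  alone controls the loss.\<close>

lemma lcs_set_zero: "lcs z \<le> Suc (lcs (set_zero z i))"
proof (cases "(z, i)" rule: set_zero.cases)
  case (1 x y j)
  then show ?thesis using lcs_update_fst[of x y j False] by simp
next
  case (2 x y j)
  then show ?thesis
    using lcs_update_fst[of y x j False] by (simp add: lcs_commute[of x])
qed

section \<open>Word pairs with a given number of zeros\<close>

definition words :: "nat \<Rightarrow> word_pair set" where
  "words n = {x. length x = n} \<times> {y. length y = n}"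

text \<open>All pairs in this set have the same mass under \<open>Z_law p n\<close>, so for
  \<open>0 < p < 1\<close> and \<open>u \<le> 2 * n\<close> conditioning on \<open>u\<close> zeros
  gives the uniform law on it.\<close>

definition level :: "nat \<Rightarrow> nat \<Rightarrow> word_pair set" where
  "level n u = {z \<in> words n. zeros z = u}"

lemma finite_words [simp]: "finite (words n)"
proof -
  have "finite {x :: bool list. length x = n}"
    using finite_lists_length_eq[of "UNIV :: bool set" n] by simp
  then show ?thesis by (simp add: words_def)
qed

lemma finite_level [simp]: "finite (level n u)"
  by (rule finite_subset[OF _ finite_words[of n]]) (auto simp: level_def)

lemma zeros_le: "z \<in> words n \<Longrightarrow> zeros z \<le> 2 * n"
  using count_le_length[of "fst z" False] count_le_length[of "snd z" False]
  by (auto simp: words_def zeros_def)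

section \<open>Moves between neighbouring levels\<close>

fun set_one :: "word_pair \<Rightarrow> nat + nat \<Rightarrow> word_pair" where
  "set_one (x, y) (Inl i) = (x[i := True], y)"
| "set_one (x, y) (Inr i) = (x, y[i := True])"

definition zero_positions :: "word_pair \<Rightarrow> (nat + nat) set" where
  "zero_positions z =
     {i. i < length (fst z) \<and> \<not> fst z ! i} <+> {i. i < length (snd z) \<and> \<not> snd z ! i}"

lemma count_list_card: "count_list xs a = card {i. i < length xs \<and> xs ! i = a}"
  unfolding count_list_eq_length_filter length_filter_conv_card
  by (intro arg_cong[where f = card] Collect_cong) auto

lemma card_zero_positions: "card (zero_positions z) = zeros z"
  by (subst zero_positions_def, subst card_Plus) (simp_all add: zeros_def count_list_card)

lemma card_one_positions:
  assumes "z \<in> words n"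
  shows "card (one_positions z) = 2 * n - zeros z"
proof -
  have ones: "card {i. i < length xs \<and> xs ! i} = length xs - count_list xs False" for xs
  proof -
    have "count_list xs True + count_list xs False = length xs"
      by (induction xs) auto
    then show ?thesis by (simp add: count_list_card)
  qed
  have "length (fst z) = n" "length (snd z) = n"
    using assms by (auto simp: words_def)
  then show ?thesis
    using ones[of "fst z"] ones[of "snd z"] count_le_length[of "fst z" False] count_le_length[of "snd z" False]
    by (simp add: one_positions_def card_Plus zeros_def words_def mem_Times_iff)
qed

lemma finite_one_positions [simp]: "finite (one_positions z)"
  by (simp add: one_positions_def)

lemma finite_zero_positions [simp]: "finite (zero_positions z)"
  by (simp add: zero_positions_def)

text \<open>Placing the indicators of the old and the new letter on opposite sides avoids
  subtraction of natural numbers.\<close>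

lemma count_list_update:
  "i < length xs \<Longrightarrow> count_list (xs[i := a]) b + of_bool (xs ! i = b) = count_list xs b + of_bool (a = b)"
proof (induction xs arbitrary: i)
  case (Cons x xs)
  show ?case using Cons.IH[of "i - 1"] Cons.prems by (cases i) (auto simp: of_bool_def split: if_splits)
qed simp

lemma Inl_one_positions [simp]: "Inl j \<in> one_positions (x, y) \<longleftrightarrow> j < length x \<and> x ! j"
  and Inr_one_positions [simp]: "Inr j \<in> one_positions (x, y) \<longleftrightarrow> j < length y \<and> y ! j"
  by (auto simp: one_positions_def)

lemma Inl_zero_positions [simp]: "Inl j \<in> zero_positions (x, y) \<longleftrightarrow> j < length x \<and> \<not> x ! j"
  and Inr_zero_positions [simp]: "Inr j \<in> zero_positions (x, y) \<longleftrightarrow> j < length y \<and> \<not> y ! j"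
  by (auto simp: zero_positions_def)

lemma level_pair [simp]:
  "(x, y) \<in> level n u \<longleftrightarrow>
    length x = n \<and> length y = n \<and> count_list x False + count_list y False = u"
  by (auto simp: level_def words_def zeros_def)

text \<open>Together with \<open>set_one_level\<close> this makes \<open>set_zero\<close> and
  \<open>set_one\<close> inverse bijections between pairs with a marked one on level
  \<open>u\<close> and pairs with a marked zero on level \<open>Suc u\<close>.\<close>

lemma set_zero_level:
  assumes "z \<in> level n u" "i \<in> one_positions z"
  shows "set_zero z i \<in> level n (Suc u)" "i \<in> zero_positions (set_zero z i)"
    "set_one (set_zero z i) i = z"
proof -
  have *: "count_list (xs[j := False]) False = Suc (count_list xs False)"
    "xs[j := True] = xs" if "j < length xs" "xs ! j" for xs j
    using count_list_update[OF that(1), of False False] list_update_id[of xs j] that(2) by simp_all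
  obtain x y where z: "z = (x, y)" by (cases z)
  show "set_zero z i \<in> level n (Suc u)" "i \<in> zero_positions (set_zero z i)"
    "set_one (set_zero z i) i = z"
    using assms by (cases i; simp add: z *)+
qed

lemma set_one_level:
  assumes "z \<in> level n (Suc u)" "i \<in> zero_positions z"
  shows "set_one z i \<in> level n u" "i \<in> one_positions (set_one z i)"
    "set_zero (set_one z i) i = z"
proof -
  have *: "count_list xs False = Suc (count_list (xs[j := True]) False)"
    "xs[j := False] = xs" if "j < length xs" "\<not> xs ! j" for xs j
    using count_list_update[OF that(1), of True False] list_update_id[of xs j] that(2) by simp_all
  obtain x y where z: "z = (x, y)" by (cases z)
  \<comment> \<open>In \<open>*(1)\<close> the index \<open>j\<close> occurs only on the right, so
    it is instantiated by hand; \<open>projl i\<close> and \<open>projr i\<close> matter only in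
    their own case of \<open>i\<close>.\<close>
  show "set_one z i \<in> level n u"
    using assms *(1)[of "projl i" x] *(1)[of "projr i" y] by (cases i) (simp_all add: z)
  show "i \<in> one_positions (set_one z i)" "set_zero (set_one z i) i = z"
    using assms by (cases i; simp add: z *(2))+
qed

lemma expectation_Z_tilde:
  assumes "z \<in> level n u" "u < 2 * n"
  shows "measure_pmf.expectation (Z_tilde z) f =
    (\<Sum>i\<in>one_positions z. f (set_zero z i)) / (2 * real n - real u)"
proof -
  have c: "card (one_positions z) = 2 * n - u"
    using card_one_positions[of z n] assms(1) by (simp add: level_def)
  \<comment> \<open>The strict bound on \<open>u\<close> leaves at least one one, which excludes the
    default branch of \<open>Z_tilde\<close>.\<close>
  then have "one_positions z \<noteq> {}"
    using assms(2) by auto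
  then show ?thesis
    using c assms(2) by (simp add: Z_tilde_def integral_pmf_of_set of_nat_diff)
qed

text \<open>Double counting of the pairs of a word pair and a position of a one in it.\<close>
lemma sum_level_Z_tilde:
  fixes f :: "word_pair \<Rightarrow> real"
  assumes "u < 2 * n"
  shows "(\<Sum>z\<in>level n u. measure_pmf.expectation (Z_tilde z) f) =
    (real u + 1) / (2 * real n - real u) * (\<Sum>z\<in>level n (Suc u). f z)"
proof -
  have "(\<Sum>z\<in>level n u. \<Sum>i\<in>one_positions z. f (set_zero z i)) =
      (\<Sum>(z, i)\<in>Sigma (level n u) one_positions. f (set_zero z i))"
    by (simp add: sum.Sigma)
  also have "\<dots> = (\<Sum>(z, i)\<in>Sigma (level n (Suc u)) zero_positions. f z)"
    by (rule sum.reindex_bij_witness[where i = "\<lambda>(z, i). (set_one z i, i)"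
          and j = "\<lambda>(z, i). (set_zero z i, i)"])
       (auto simp: set_zero_level set_one_level)
  also have "\<dots> = (\<Sum>z\<in>level n (Suc u). \<Sum>i\<in>zero_positions z. f z)"
    by (rule sum.Sigma[symmetric]) auto
  also have "\<dots> = (real u + 1) * (\<Sum>z\<in>level n (Suc u). f z)"
    by (simp add: card_zero_positions sum_distrib_left level_def add.commute)
  finally show ?thesis
    using assms by (simp add: expectation_Z_tilde sum_divide_distrib[symmetric])
qed

text \<open>For a constant function the double counting reduces to the ratio of consecutive binomial
  coefficients of \<open>2 * n\<close>.\<close>

lemma card_level_Suc:
  assumes "u < 2 * n"
  shows "real (card (level n u)) =
    (real u + 1) / (2 * real n - real u) * real (card (level n (Suc u)))"
  using sum_level_Z_tilde[OF assms, of "\<lambda>_. 1"] by simp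

text \<open>The recursion for the cardinalities carries positivity upwards from the pair consisting
  of ones only.\<close>

lemma level_nonempty:
  assumes "u \<le> 2 * n"
  shows "level n u \<noteq> {}"
  using assms
proof (induction u)
  case 0
  have "(replicate n True, replicate n True) \<in> level n 0"
    by (simp add: level_def words_def zeros_def count_list_0_iff)
  then show ?case by blast
next
  case (Suc u)
  then have "real (card (level n u)) > 0" by (simp add: card_gt_0_iff)
  then show ?case
    using card_level_Suc[of u n] Suc.prems by (auto)
qed

section \<open>The law of the number of zeros\<close>

lemma finite_set_replicate_pmf: "finite (set_pmf (replicate_pmf n (bernoulli_pmf p)))"
proof (rule finite_subset)
  show "set_pmf (replicate_pmf n (bernoulli_pmf p)) \<subseteq> {xs. set xs \<subseteq> UNIV \<and> length xs = n}"
    by (auto simp: set_replicate_pmf)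
qed (rule finite_lists_length_eq, simp)

lemma pmf_replicate_bernoulli:
  assumes "0 \<le> p" "p \<le> 1"
  shows "pmf (replicate_pmf (length xs) (bernoulli_pmf p)) xs =
    p ^ (length xs - count_list xs False) * (1 - p) ^ count_list xs False"
proof (induction xs)
  case (Cons x xs)
  have eq: "replicate_pmf (Suc n) (bernoulli_pmf p) =
      map_pmf (\<lambda>(x, xs). x # xs) (pair_pmf (bernoulli_pmf p) (replicate_pmf n (bernoulli_pmf p)))" for n
    by (simp add: pair_pmf_def map_bind_pmf)
  have "inj (\<lambda>(x, xs). x # xs :: bool list)"
    by (auto simp: inj_def)
  from pmf_map_inj'[OF this, of _ "(x, xs)"] have
    "pmf (replicate_pmf (Suc (length xs)) (bernoulli_pmf p)) (x # xs) =
      pmf (bernoulli_pmf p) x * pmf (replicate_pmf (length xs) (bernoulli_pmf p)) xs"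
    by (simp only: eq) (simp add: pmf_pair)
  then show ?case
    using Cons assms count_le_length[of xs False] by (cases x) (auto simp: Suc_diff_le)
qed simp

lemma pmf_Z_law:
  assumes "0 \<le> p" "p \<le> 1" "z \<in> level n u"
  shows "pmf (Z_law p n) z = p ^ (2 * n - u) * (1 - p) ^ u"
proof -
  obtain x y where z: "z = (x, y)" by (cases z)
  have len: "length x = n" "length y = n" and u: "u = count_list x False + count_list y False"
    using assms(3) by (auto simp: z)
  have "2 * n - u = (n - count_list x False) + (n - count_list y False)"
    using count_le_length[of x False] count_le_length[of y False] by (simp add: len u)
  then show ?thesis
    using pmf_replicate_bernoulli[OF assms(1,2), of x] pmf_replicate_bernoulli[OF assms(1,2), of y]
    by (simp add: Z_law_def z pmf_pair len u power_add)
qed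

lemma set_Z_law: "set_pmf (Z_law p n) \<subseteq> words n"
  by (auto simp: Z_law_def words_def set_replicate_pmf)

lemma expectation_Z_law:
  fixes f :: "word_pair \<Rightarrow> real"
  shows "measure_pmf.expectation (Z_law p n) f = (\<Sum>u\<le>2 * n. \<Sum>z\<in>level n u. f z * pmf (Z_law p n) z)"
proof -
  have "measure_pmf.expectation (Z_law p n) f = (\<Sum>z\<in>words n. f z * pmf (Z_law p n) z)"
    using set_Z_law by (intro integral_measure_pmf_real) auto
  also have "\<dots> = (\<Sum>u\<le>2 * n. \<Sum>z\<in>level n u. f z * pmf (Z_law p n) z)"
    unfolding level_def using zeros_le by (intro sum.group[symmetric]) auto
  finally show ?thesis .
qed

abbreviation prob_zeros :: "real \<Rightarrow> nat \<Rightarrow> nat \<Rightarrow> real" where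
  "prob_zeros p n u \<equiv> measure_pmf.prob (Z_law p n) {z. zeros z = u}"

lemma prob_Z_law_level:
  "measure_pmf.prob (Z_law p n) (A \<inter> {z. zeros z = u}) = (\<Sum>z\<in>A \<inter> level n u. pmf (Z_law p n) z)"
proof -
  have "measure_pmf.prob (Z_law p n) (A \<inter> {z. zeros z = u}) = measure_pmf.prob (Z_law p n) (A \<inter> level n u)"
    using set_Z_law by (intro measure_prob_cong_0) (auto simp: level_def set_pmf_eq)
  then show ?thesis by (simp add: measure_measure_pmf_finite)
qed

lemma prob_zeros_eq:
  fixes p :: real
  assumes "0 \<le> p" "p \<le> 1"
  shows "prob_zeros p n u = card (level n u) * (p ^ (2 * n - u) * (1 - p) ^ u)"
proof -
  have "prob_zeros p n u = (\<Sum>z\<in>level n u. pmf (Z_law p n) z)"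
    using prob_Z_law_level[of p n UNIV u] by simp
  also have "\<dots> = (\<Sum>z\<in>level n u. p ^ (2 * n - u) * (1 - p) ^ u)"
    by (intro sum.cong refl pmf_Z_law assms)
  finally show ?thesis by simp
qed

lemma expectation_zeros:
  fixes f :: "nat \<Rightarrow> real"
  shows "measure_pmf.expectation (Z_law p n) (\<lambda>z. f (zeros z)) = (\<Sum>u\<le>2 * n. f u * prob_zeros p n u)"
  unfolding expectation_Z_law
  using prob_Z_law_level[of p n UNIV]
  by (intro sum.cong refl) (simp add: sum_distrib_left level_def)

lemma sum_prob_zeros: "(\<Sum>u\<le>2 * n. prob_zeros p n u) = 1"
  using expectation_zeros[of p n "\<lambda>_. 1"] by simp

text \<open>The conditional weights are all \<open>?w / prob_zeros p n u\<close>, in which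
  \<open>?w\<close> cancels and the reciprocal of the cardinality remains.\<close>

lemma ell_eq:
  assumes "0 < p" "p < 1" "u \<le> 2 * n"
  shows "ell p n u = (\<Sum>z\<in>level n u. real (lcs z)) / card (level n u)"
proof -
  let ?w = "p ^ (2 * n - u) * (1 - p) ^ u"
  obtain z where z: "z \<in> level n u" using level_nonempty[OF assms(3)] by blast
  have w: "?w > 0" using assms by simp
  then have "z \<in> set_pmf (Z_law p n)"
    using pmf_Z_law[OF _ _ z] assms by (simp add: set_pmf_iff)
  \<comment> \<open>\<open>cond_pmf\<close> is specified only for an event that meets the
    support.\<close>
  then have ne: "set_pmf (Z_law p n) \<inter> {z. zeros z = u} \<noteq> {}"
    using z by (auto simp: level_def)
  have "ell p n u = (\<Sum>z\<in>level n u. real (lcs z) * pmf (cond_pmf (Z_law p n) {z. zeros z = u}) z)"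
    unfolding ell_def
    using set_Z_law by (intro integral_measure_pmf_real) (auto simp: set_cond_pmf[OF ne] level_def)
  also have "\<dots> = (\<Sum>z\<in>level n u. real (lcs z) * (?w / prob_zeros p n u))"
    using assms pmf_Z_law[of p _ n u]
    by (intro sum.cong refl) (auto simp: pmf_cond[OF ne] level_def)
  also have "\<dots> = (\<Sum>z\<in>level n u. real (lcs z)) * (?w / prob_zeros p n u)"
    by (rule sum_distrib_right[symmetric])
  also have "?w / prob_zeros p n u = 1 / card (level n u)"
    using w prob_zeros_eq[where p = p and n = n and u = u] assms by simp
  finally show ?thesis by simp
qed

section \<open>Exponential moments and upper tail of the number of zeros\<close>

lemma expectation_count_list:
  assumes "0 \<le> p" "p \<le> 1"
  shows "measure_pmf.expectation (replicate_pmf n (bernoulli_pmf p))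
    (\<lambda>xs. exp (s * (real (count_list xs False) - real n * (1 - p)))) = mgf (1 - p) s ^ n"
proof (induction n)
  case (Suc n)
  let ?E = "\<lambda>xs. exp (s * (real (count_list xs False) - real n * (1 - p)))"
  \<comment> \<open>The counted letter is \<open>False\<close>, hence
    \<open>of_bool (\<not> x)\<close>; the centring is shared out letter by letter, so that the
    first letter splits off as a factor.\<close>
  have shift: "exp (s * (real (count_list (x # xs) False) - real (Suc n) * (1 - p))) =
      exp (s * (of_bool (\<not> x) - (1 - p))) * ?E xs" for x xs
    by (auto simp: algebra_simps simp flip: exp_add)
  have "measure_pmf.expectation (replicate_pmf (Suc n) (bernoulli_pmf p)) f =
      measure_pmf.expectation (bernoulli_pmf p) (\<lambda>x.
        measure_pmf.expectation (replicate_pmf n (bernoulli_pmf p)) (\<lambda>xs. f (x # xs)))"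
    for f :: "bool list \<Rightarrow> real"
  proof -
    let ?R = "replicate_pmf n (bernoulli_pmf p)"
    have fin: "finite (set_pmf (?R \<bind> (\<lambda>xs. return_pmf (x # xs))))" for x
      using finite_set_replicate_pmf[of n p] by simp
    have inner: "measure_pmf.expectation (?R \<bind> (\<lambda>xs. return_pmf (x # xs))) f =
        measure_pmf.expectation ?R (\<lambda>xs. f (x # xs))" for x
      by (simp add: integral_map_pmf flip: map_pmf_def)
    show ?thesis
      unfolding replicate_pmf.simps inner[symmetric]
      by (subst pmf_expectation_bind[where A = UNIV], use fin in simp_all)
         (subst integral_measure_pmf[where A = UNIV], auto)
  qed
  then have "measure_pmf.expectation (replicate_pmf (Suc n) (bernoulli_pmf p))
      (\<lambda>xs. exp (s * (real (count_list xs False) - real (Suc n) * (1 - p)))) =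
      measure_pmf.expectation (bernoulli_pmf p) (\<lambda>x. exp (s * (of_bool (\<not> x) - (1 - p))) *
        measure_pmf.expectation (replicate_pmf n (bernoulli_pmf p)) ?E)"
    by (simp only: shift integral_mult_right_zero)
  also have "\<dots> = mgf (1 - p) s * mgf (1 - p) s ^ n"
    unfolding Suc using assms by (simp add: mgf_def algebra_simps)
  finally show ?case by simp
qed simp

text \<open>The centred number of zeros is a sum of \<open>2 * n\<close> independent centred
  Bernoulli variables; each of the two independent words contributes
  \<open>mgf (1 - p) s ^ n\<close>.\<close>

lemma sum_prob_zeros_exp:
  assumes "0 \<le> p" "p \<le> 1"
  shows "(\<Sum>u\<le>2 * n. exp (s * (real u - 2 * real n * (1 - p))) * prob_zeros p n u) = mgf (1 - p) s ^ (2 * n)"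
proof -
  let ?R = "replicate_pmf n (bernoulli_pmf p)"
  let ?E = "\<lambda>xs. exp (s * (real (count_list xs False) - real n * (1 - p)))"
  have "(\<Sum>u\<le>2 * n. exp (s * (real u - 2 * real n * (1 - p))) * prob_zeros p n u) =
      measure_pmf.expectation (Z_law p n) (\<lambda>z. exp (s * (real (zeros z) - 2 * real n * (1 - p))))"
    by (rule expectation_zeros[symmetric])
  also have "\<dots> = measure_pmf.expectation (pair_pmf ?R ?R) (\<lambda>z. ?E (fst z) * ?E (snd z))"
    unfolding Z_law_def
    by (intro Bochner_Integration.integral_cong) (auto simp: zeros_def algebra_simps simp flip: exp_add)
  also have "\<dots> = (\<Sum>z\<in>set_pmf ?R \<times> set_pmf ?R. ?E (fst z) * ?E (snd z) * pmf (pair_pmf ?R ?R) z)"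
    by (intro integral_measure_pmf_real) (auto simp: finite_set_replicate_pmf)
  also have "\<dots> = (\<Sum>x\<in>set_pmf ?R. ?E x * pmf ?R x) * (\<Sum>x\<in>set_pmf ?R. ?E x * pmf ?R x)"
    unfolding sum_product sum.cartesian_product
    by (intro sum.cong) (auto simp: pmf_pair)
  also have "(\<Sum>x\<in>set_pmf ?R. ?E x * pmf ?R x) = measure_pmf.expectation ?R ?E"
    by (intro integral_measure_pmf_real[symmetric]) (auto simp: finite_set_replicate_pmf)
  also have "\<dots> = mgf (1 - p) s ^ n"
    by (rule expectation_count_list[OF assms])
  also have "mgf (1 - p) s ^ n * mgf (1 - p) s ^ n = mgf (1 - p) s ^ (2 * n)"
    by (simp only: power_add mult_2)
  finally show ?thesis .
qed

text \<open>Hoeffding's lemma for a centred variable with values in an interval of length 1.\<close>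

lemma mgf_le:
  assumes "0 \<le> q" "q \<le> 1" "s > 0"
  shows "mgf q s \<le> exp (s\<^sup>2 / 8)"
proof -
  interpret interval_bounded_random_variable "measure_pmf (bernoulli_pmf q)"
    "\<lambda>x. of_bool x - q" "- q" "1 - q"
    by unfold_locales (use assms in auto)
  have "ennreal (mgf q s) = (\<integral>\<^sup>+x. exp (s * (of_bool x - q)) \<partial>bernoulli_pmf q)"
    using assms by (simp add: mgf_def ennreal_plus[symmetric] ennreal_mult'[symmetric] mult.commute del: ennreal_plus)
  also have "\<dots> \<le> ennreal (exp (s\<^sup>2 * ((1 - q) - (- q))\<^sup>2 / 8))"
    using assms by (intro Hoeffdings_lemma_nn_integral_0) (auto simp: algebra_simps)
  finally show ?thesis by simp
qed

text \<open>With parameter \<open>r\<close> the Chernoff bound has exponent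
  \<open>- r * b * n + r^2 * n / 4\<close>; the choice \<open>r = 2 * b\<close> minimises
  it.\<close>

lemma sum_prob_zeros_tail:
  assumes "0 \<le> p" "p \<le> 1" "b > 0"
  shows "(\<Sum>u | u \<le> 2 * n \<and> real u - 2 * real n * (1 - p) \<ge> b * real n. prob_zeros p n u) \<le> exp (- b\<^sup>2 * real n)"
proof -
  let ?A = "{u. u \<le> 2 * n \<and> real u - 2 * real n * (1 - p) \<ge> b * real n}"
  let ?e = "\<lambda>u. exp (2 * b * (real u - 2 * real n * (1 - p)))"
  have "exp (2 * b * (b * real n)) * (\<Sum>u\<in>?A. prob_zeros p n u) \<le> (\<Sum>u\<in>?A. ?e u * prob_zeros p n u)"
    unfolding sum_distrib_left using assms by (intro sum_mono mult_right_mono) auto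
  also have "\<dots> \<le> (\<Sum>u\<le>2 * n. ?e u * prob_zeros p n u)"
    by (intro sum_mono2) auto
  also have "\<dots> = mgf (1 - p) (2 * b) ^ (2 * n)"
    by (rule sum_prob_zeros_exp[OF assms(1,2)])
  also have "\<dots> \<le> exp ((2 * b)\<^sup>2 / 8) ^ (2 * n)"
    using assms by (intro power_mono mgf_le) (auto simp: mgf_def)
  also have "\<dots> = exp (2 * b * (b * real n)) * exp (- b\<^sup>2 * real n)"
    by (simp add: exp_of_nat_mult[symmetric] power2_eq_square algebra_simps flip: exp_add)
  finally show ?thesis by simp
qed

section \<open>Increments of the conditional mean\<close>

lemma finite_set_Z_tilde: "finite (set_pmf (Z_tilde z))"
  by (simp add: Z_tilde_def set_pmf_of_set)

lemma Z_tilde_lcs: "z' \<in> set_pmf (Z_tilde z) \<Longrightarrow> lcs z \<le> Suc (lcs z')"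
  using lcs_set_zero[of z] by (auto simp: Z_tilde_def set_pmf_of_set split: if_splits)

text \<open>On the support of \<open>Z_tilde z\<close> the drop is at most one, so
  \<open>lcs z'\<close> dominates \<open>lcs z\<close> plus the indicator of a rise minus that of a
  fall; it remains to integrate.\<close>

lemma expectation_lcs_Z_tilde_ge:
  "measure_pmf.expectation (Z_tilde z) (\<lambda>z'. real (lcs z')) \<ge> real (lcs z)
    + measure_pmf.prob (Z_tilde z) {z'. int (lcs z') - int (lcs z) = 1}
    - measure_pmf.prob (Z_tilde z) {z'. int (lcs z') - int (lcs z) = - 1}"
proof -
  let ?up = "{z'. int (lcs z') - int (lcs z) = 1}" and ?down = "{z'. int (lcs z') - int (lcs z) = - 1}"
  have "measure_pmf.expectation (Z_tilde z) (\<lambda>z'. real (lcs z) + indicator ?up z' - indicator ?down z')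
      \<le> measure_pmf.expectation (Z_tilde z) (\<lambda>z'. real (lcs z'))"
    using Z_tilde_lcs[of _ z]
    by (intro integral_mono_AE integrable_measure_pmf_finite finite_set_Z_tilde)
       (fastforce simp: AE_measure_pmf_iff indicator_def)
  also have "measure_pmf.expectation (Z_tilde z) (\<lambda>z'. real (lcs z) + indicator ?up z' - indicator ?down z') =
      real (lcs z) + measure_pmf.prob (Z_tilde z) ?up - measure_pmf.prob (Z_tilde z) ?down"
    by (simp add: integrable_measure_pmf_finite finite_set_Z_tilde)
  finally show ?thesis .
qed

lemma expectation_lcs_Z_tilde_ge_minus_one:
  "measure_pmf.expectation (Z_tilde z) (\<lambda>z'. real (lcs z')) \<ge> real (lcs z) - 1"
  using expectation_lcs_Z_tilde_ge[of z]
    measure_nonneg[of "Z_tilde z" "{z'. int (lcs z') - int (lcs z) = 1}"]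
    measure_pmf.prob_le_1[of "Z_tilde z" "{z'. int (lcs z') - int (lcs z) = - 1}"]
  by linarith

text \<open>Passing through \<open>Z_tilde\<close> turns the increment into an average over level
  \<open>u\<close>. The mean change is at least \<open>\<epsilon>\<close> on \<open>B\<close> and at
  least \<open>- 1 = \<epsilon> - (1 + \<epsilon>)\<close> off \<open>B\<close>, whence the form of
  the bound.\<close>

lemma ell_Suc_diff_ge:
  fixes p \<epsilon> :: real
  assumes p: "0 < p" "p < 1" and u: "u < 2 * n"
    and B: "\<And>z. z \<in> B \<Longrightarrow> measure_pmf.expectation (Z_tilde z) (\<lambda>z'. real (lcs z')) \<ge> real (lcs z) + \<epsilon>"
  shows "ell p n (Suc u) - ell p n u \<ge>
    \<epsilon> - (1 + \<epsilon>) * (measure_pmf.prob (Z_law p n) (- B \<inter> {z. zeros z = u}) / prob_zeros p n u)"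
proof -
  let ?S = "level n u" and ?w = "p ^ (2 * n - u) * (1 - p) ^ u"
  let ?N = "real (card ?S)"
  have N: "?N > 0" using level_nonempty[of u n] u by (simp add: card_gt_0_iff)
  have w: "?w > 0" using p by simp
  \<comment> \<open>The ratio \<open>(u + 1) / (2 * n - u)\<close> from the double counting cancels
    against the same ratio of the level sizes.\<close>
  have "ell p n (Suc u) = (\<Sum>z\<in>?S. measure_pmf.expectation (Z_tilde z) (\<lambda>z'. real (lcs z'))) / ?N"
    using u p N by (simp add: ell_eq sum_level_Z_tilde card_level_Suc)
  moreover have "ell p n u = (\<Sum>z\<in>?S. real (lcs z)) / ?N"
    using u p by (simp add: ell_eq)
  ultimately have diff: "ell p n (Suc u) - ell p n u =
      (\<Sum>z\<in>?S. measure_pmf.expectation (Z_tilde z) (\<lambda>z'. real (lcs z')) - real (lcs z)) / ?N"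
    by (simp add: sum_subtractf diff_divide_distrib)
  have "(\<Sum>z\<in>?S. \<epsilon> - (1 + \<epsilon>) * indicator (- B) z) \<le>
      (\<Sum>z\<in>?S. measure_pmf.expectation (Z_tilde z) (\<lambda>z'. real (lcs z')) - real (lcs z))"
  proof (rule sum_mono)
    fix z
    show "\<epsilon> - (1 + \<epsilon>) * indicator (- B) z \<le>
        measure_pmf.expectation (Z_tilde z) (\<lambda>z'. real (lcs z')) - real (lcs z)"
      using B[of z] expectation_lcs_Z_tilde_ge_minus_one[of z] by (cases "z \<in> B") auto
  qed
  moreover have "(\<Sum>z\<in>?S. \<epsilon> - (1 + \<epsilon>) * indicator (- B) z) = \<epsilon> * ?N - (1 + \<epsilon>) * real (card (- B \<inter> ?S))"
    by (simp add: sum_subtractf indicator_def Int_commute Compl_eq sum.If_cases flip: sum_distrib_left)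
  moreover have "measure_pmf.prob (Z_law p n) (- B \<inter> {z. zeros z = u}) = real (card (- B \<inter> ?S)) * ?w"
  proof -
    have "(\<Sum>z\<in>- B \<inter> ?S. pmf (Z_law p n) z) = (\<Sum>z\<in>- B \<inter> ?S. ?w)"
      using p by (intro sum.cong refl pmf_Z_law) auto
    then show ?thesis by (simp add: prob_Z_law_level)
  qed
  then have "measure_pmf.prob (Z_law p n) (- B \<inter> {z. zeros z = u}) / prob_zeros p n u = real (card (- B \<inter> ?S)) / ?N"
    using p w prob_zeros_eq[where p = p and n = n and u = u] by simp
  moreover have "\<epsilon> - (1 + \<epsilon>) * (real (card (- B \<inter> ?S)) / ?N) = (\<epsilon> * ?N - (1 + \<epsilon>) * real (card (- B \<inter> ?S))) / ?N"
    using N by (auto simp: diff_divide_distrib)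
  ultimately show ?thesis
    unfolding diff using N by (simp only: divide_right_mono less_imp_le)
qed

text \<open>Jensen's inequality on each level: the exponential lies above its tangent at the conditional mean.\<close>
lemma expectation_exp_lcs_ge:
  fixes a t :: real
  assumes "0 < p" "p < 1"
  shows "measure_pmf.expectation (Z_law p n) (\<lambda>z. exp (t * (real (lcs z) - a))) \<ge>
    (\<Sum>u\<le>2 * n. exp (t * (ell p n u - a)) * prob_zeros p n u)"
  unfolding expectation_Z_law
proof (rule sum_mono)
  fix u
  assume "u \<in> {..2 * n}"
  then have u: "u \<le> 2 * n" by simp
  let ?S = "level n u" and ?w = "p ^ (2 * n - u) * (1 - p) ^ u" and ?l = "ell p n u"
  have "real (card ?S) > 0" using level_nonempty[OF u] by (simp add: card_gt_0_iff)
  then have mean: "(\<Sum>z\<in>?S. real (lcs z)) = real (card ?S) * ?l"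
    using assms u by (simp add: ell_eq)
  have tangent: "exp (t * (?l - a)) * (1 + t * (real k - ?l)) \<le> exp (t * (real k - a))" for k
  proof -
    have "exp (t * (?l - a)) * (1 + t * (real k - ?l)) \<le> exp (t * (?l - a)) * exp (t * (real k - ?l))"
      using exp_ge_add_one_self by (intro mult_left_mono) auto
    also have "\<dots> = exp (t * (real k - a))"
      by (simp add: algebra_simps flip: exp_add)
    finally show ?thesis .
  qed
  \<comment> \<open>By \<open>mean\<close> the linear terms of the tangents sum to zero over the
    level.\<close>
  have "exp (t * (?l - a)) * prob_zeros p n u = (\<Sum>z\<in>?S. exp (t * (?l - a)) * (1 + t * (real (lcs z) - ?l))) * ?w"
    using assms mean
    by (simp add: prob_zeros_eq sum.distrib sum_subtractf flip: sum_distrib_left)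
  also have "\<dots> \<le> (\<Sum>z\<in>?S. exp (t * (real (lcs z) - a))) * ?w"
    using assms tangent by (intro mult_right_mono sum_mono) auto
  also have "\<dots> = (\<Sum>z\<in>?S. exp (t * (real (lcs z) - a)) * pmf (Z_law p n) z)"
    unfolding sum_distrib_right using assms pmf_Z_law[of p _ n u] by (intro sum.cong refl) auto
  finally show "exp (t * (?l - a)) * prob_zeros p n u \<le> (\<Sum>z\<in>?S. exp (t * (real (lcs z) - a)) * pmf (Z_law p n) z)" .
qed

section \<open>The moment generating function\<close>

lemma mgf_0 [simp]: "mgf q 0 = 1"
  by (simp add: mgf_def)

text \<open>Both exponentials are compared with their tangents at 0, the first one strictly; the
  linear terms cancel because the variable is centred.\<close>

lemma mgf_gt_1:
  assumes "0 < q" "q < 1" "s > 0"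
  shows "mgf q s > 1"
proof -
  have "1 + s * (1 - q) < exp (s * (1 - q))"
    using assms exp_minus_greater[of "- (s * (1 - q))"] by simp
  then have "(1 + s * (1 - q)) * q < exp (s * (1 - q)) * q"
    using assms by simp
  moreover have "(1 + (- s * q)) * (1 - q) \<le> exp (- s * q) * (1 - q)"
    using assms exp_ge_add_one_self[of "- s * q"] by (intro mult_right_mono) auto
  ultimately show ?thesis
    unfolding mgf_def by (simp add: algebra_simps)
qed

text \<open>The factor \<open>exp (- s)\<close> leaves only decaying exponentials, so that
  monotonicity and the comparison with \<open>exp (- (s * q))\<close> hold term by term.\<close>

lemma exp_minus_mgf:
  "exp (- s) * mgf q s = q * exp (- (s * q)) + (1 - q) * exp (- (s * (1 + q)))"
  by (simp add: mgf_def algebra_simps flip: exp_add)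

lemma mgf_pos: "0 < q \<Longrightarrow> q < 1 \<Longrightarrow> mgf q s > 0"
  by (simp add: mgf_def add_pos_pos)

lemma diff_ln_mgf:
  assumes "0 < q" "q < 1"
  shows "s - ln (mgf q s) = - ln (exp (- s) * mgf q s)"
  using mgf_pos[OF assms, of s] by (simp add: ln_mult)

lemma diff_ln_mgf_strict_mono:
  assumes "0 < q" "q < 1"
  shows "strict_mono (\<lambda>s. s - ln (mgf q s))"
proof (rule strict_monoI)
  fix r s :: real
  assume "r < s"
  then have "exp (- s) * mgf q s < exp (- r) * mgf q r"
    unfolding exp_minus_mgf using assms by (intro add_strict_mono mult_strict_left_mono) auto
  then show "r - ln (mgf q r) < s - ln (mgf q s)"
    unfolding diff_ln_mgf[OF assms] using mgf_pos[OF assms] by simp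
qed

lemma diff_ln_mgf_ge:
  assumes "0 < q" "q < 1" "0 \<le> s"
  shows "s * q \<le> s - ln (mgf q s)"
proof -
  have "exp (- s) * mgf q s \<le> q * exp (- (s * q)) + (1 - q) * exp (- (s * q))"
    unfolding exp_minus_mgf using assms by (intro add_left_mono mult_left_mono) (auto simp: algebra_simps)
  then have "exp (- s) * mgf q s \<le> exp (- (s * q))"
    by (simp add: algebra_simps)
  then have "ln (exp (- s) * mgf q s) \<le> - (s * q)"
    using mgf_pos[OF assms(1,2), of s] ln_mono[of "exp (- s) * mgf q s"] by fastforce
  then show ?thesis
    using diff_ln_mgf[OF assms(1,2), of s] by linarith
qed

text \<open>In the variable \<open>s = \<delta> * t\<close> the function \<open>?h\<close> vanishes
  at 0 and has reached \<open>c\<close> at \<open>c / q\<close>, since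
  \<open>?h s \<ge> s * q\<close>. Continuity gives existence, strict monotonicity
  uniqueness.\<close>

lemma ex1_diff_ln_mgf_eq:
  assumes "0 < q" "q < 1" "\<delta> > 0" "c > 0"
  shows "\<exists>!t. 0 < t \<and> \<delta> * t - ln (mgf q (\<delta> * t)) = c"
proof -
  let ?h = "\<lambda>s. s - ln (mgf q s)"
  have "continuous_on {0..c / q} ?h"
    using mgf_pos[OF assms(1,2)] unfolding mgf_def
    by (intro continuous_intros) (auto simp: less_imp_neq[symmetric])
  moreover have "c \<le> ?h (c / q)"
    using diff_ln_mgf_ge[of q "c / q"] assms by simp
  ultimately obtain s where s: "0 \<le> s" "?h s = c"
    using IVT'[of ?h 0 c "c / q"] assms by auto
  then have "s \<noteq> 0" using assms by auto
  show ?thesis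
  proof (rule ex1I[of _ "s / \<delta>"])
    show "0 < s / \<delta> \<and> \<delta> * (s / \<delta>) - ln (mgf q (\<delta> * (s / \<delta>))) = c"
      using s \<open>s \<noteq> 0\<close> assms by auto
  next
    fix t
    assume "0 < t \<and> \<delta> * t - ln (mgf q (\<delta> * t)) = c"
    then have "\<delta> * t = s"
      using s strict_mono_eq[OF diff_ln_mgf_strict_mono[OF assms(1,2)], of "\<delta> * t" s] by simp
    then show "t = s / \<delta>" using assms by auto
  qed
qed

section \<open>The lower bound\<close>

text \<open>The levels are cut at \<open>m + 2\<close> and at the edge of the window.
  \<open>?L\<close> and \<open>?H\<close> collect the outer ranges; in the middle range the growth
  of \<open>ell\<close> and Jensen's inequality apply.\<close>

lemma exp_moment_split:
  fixes p t s :: real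
  assumes p: "0 < p" "p < 1" and t: "0 < t" "0 < s" and b: "0 < b"
    and m: "2 * real n * (1 - p) \<le> real m" "real m \<le> 2 * real n * (1 - p) + 1"
    and growth: "\<And>u. \<lbrakk>m \<le> u; real u - 2 * real n * (1 - p) < b * real n; u \<le> 2 * n\<rbrakk> \<Longrightarrow>
      t * (ell p n u - ell p n m) \<ge> 3 / 2 * s * (real u - real m)"
  shows "mgf (1 - p) s ^ (2 * n) \<le>
    measure_pmf.expectation (Z_law p n) (\<lambda>z. exp (t * (real (lcs z) - ell p n m)))
      + exp (3 * s) + exp (2 * real n * s * p - b\<^sup>2 * real n)"
proof -
  let ?d = "\<lambda>u. real u - 2 * real n * (1 - p)" and ?P = "prob_zeros p n"
  let ?L = "\<lambda>u. if u < m + 2 then exp (3 * s) * ?P u else 0"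
  let ?H = "\<lambda>u. if ?d u \<ge> b * real n then exp (2 * real n * s * p) * ?P u else 0"
  have "mgf (1 - p) s ^ (2 * n) = (\<Sum>u\<le>2 * n. exp (s * ?d u) * ?P u)"
    using p by (intro sum_prob_zeros_exp[symmetric]) auto
  also have "\<dots> \<le> (\<Sum>u\<le>2 * n. exp (t * (ell p n u - ell p n m)) * ?P u + ?L u + ?H u)"
  proof (rule sum_mono)
    fix u
    assume u: "u \<in> {..2 * n}"
    have nonneg: "0 \<le> exp (t * (ell p n u - ell p n m)) * ?P u" "0 \<le> ?L u" "0 \<le> ?H u"
      by auto
    consider "u < m + 2" | "?d u \<ge> b * real n" | "m + 2 \<le> u" "?d u < b * real n"
      by linarith
    then show "exp (s * ?d u) * ?P u \<le> exp (t * (ell p n u - ell p n m)) * ?P u + ?L u + ?H u"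
    proof cases
      case 1
      then have "real u \<le> real m + 1" by linarith
      \<comment> \<open>Here even \<open>?d u \<le> 2\<close> holds: one unit from
        \<open>u \<le> m + 1\<close> and one from rounding.\<close>
      then have "s * ?d u \<le> s * 3" using t m by (intro mult_left_mono) linarith+
      then have "exp (s * ?d u) * ?P u \<le> ?L u"
        using 1 by (auto intro!: mult_right_mono)
      then show ?thesis using nonneg by linarith
    next
      case 2
      \<comment> \<open>The largest deviation occurs at \<open>u = 2 * n\<close>.\<close>
      have "?d u \<le> 2 * real n * p" using u by (auto simp: algebra_simps)
      then have "s * ?d u \<le> s * (2 * real n * p)" using t by (intro mult_left_mono) auto
      also have "\<dots> = 2 * real n * s * p" by simp
      finally have "exp (s * ?d u) * ?P u \<le> exp (2 * real n * s * p) * ?P u"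
        by (intro mult_right_mono) auto
      then have "exp (s * ?d u) * ?P u \<le> ?H u"
        using 2 by simp
      then show ?thesis using nonneg by linarith
    next
      case 3
      then have "real u \<ge> real m + 2" by linarith
      \<comment> \<open>Rounding gives \<open>?d u \<le> real u - real m + 1\<close>, and from
        distance two on the extra 1 is at most half of \<open>real u - real m\<close>.\<close>
      then have "s * ?d u \<le> s * (3 / 2 * (real u - real m))"
        using t m by (intro mult_left_mono) (auto simp: field_simps)
      also have "\<dots> \<le> t * (ell p n u - ell p n m)"
        using growth[of u] 3 u by (simp add: mult_ac)
      finally have "exp (s * ?d u) * ?P u \<le> exp (t * (ell p n u - ell p n m)) * ?P u"
        by (intro mult_right_mono) auto
      then show ?thesis using nonneg by linarith
    qed
  qed
  also have "\<dots> = (\<Sum>u\<le>2 * n. exp (t * (ell p n u - ell p n m)) * ?P u) + (\<Sum>u\<le>2 * n. ?L u) + (\<Sum>u\<le>2 * n. ?H u)"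
    by (simp add: sum.distrib)
  also have "\<dots> \<le> measure_pmf.expectation (Z_law p n) (\<lambda>z. exp (t * (real (lcs z) - ell p n m)))
      + exp (3 * s) + exp (2 * real n * s * p - b\<^sup>2 * real n)"
  proof (intro add_mono)
    show "(\<Sum>u\<le>2 * n. exp (t * (ell p n u - ell p n m)) * ?P u) \<le>
        measure_pmf.expectation (Z_law p n) (\<lambda>z. exp (t * (real (lcs z) - ell p n m)))"
      by (rule expectation_exp_lcs_ge[OF p])
    have "(\<Sum>u\<le>2 * n. ?L u) \<le> (\<Sum>u\<le>2 * n. exp (3 * s) * ?P u)"
      by (intro sum_mono) auto
    also have "\<dots> = exp (3 * s)"
      by (simp add: sum_prob_zeros flip: sum_distrib_left)
    finally show "(\<Sum>u\<le>2 * n. ?L u) \<le> exp (3 * s)" .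
    have "(\<Sum>u\<le>2 * n. ?H u) = exp (2 * real n * s * p) * (\<Sum>u | u \<le> 2 * n \<and> ?d u \<ge> b * real n. ?P u)"
      by (simp add: sum_distrib_left flip: sum.inter_filter)
    also have "\<dots> \<le> exp (2 * real n * s * p) * exp (- b\<^sup>2 * real n)"
      using p b by (intro mult_left_mono sum_prob_zeros_tail) auto
    also have "\<dots> = exp (2 * real n * s * p - b\<^sup>2 * real n)"
      by (simp flip: exp_add)
    finally show "(\<Sum>u\<le>2 * n. ?H u) \<le> exp (2 * real n * s * p - b\<^sup>2 * real n)" .
  qed
  finally show ?thesis .
qed

text \<open>The increments are added level by level. Inside the window the conditional probability
  of missing \<open>B\<close> is at most \<open>exp (- c * n) / exp (- \<eta> * n)\<close>, so each
  increment falls short of \<open>\<epsilon>\<close> by at most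
  \<open>\<epsilon> / 4\<close>.\<close>

lemma ell_diff_ge:
  fixes p \<epsilon> c \<eta> b :: real
  assumes p: "0 < p" "p < 1" and \<epsilon>: "0 < \<epsilon>"
    and B: "\<And>z. z \<in> B \<Longrightarrow> measure_pmf.expectation (Z_tilde z) (\<lambda>z'. real (lcs z')) \<ge> real (lcs z) + \<epsilon>"
    and prob_B: "measure_pmf.prob (Z_law p n) B \<ge> 1 - exp (- c * real n)"
    and prob_zeros: "\<And>k. \<bar>real k - 2 * real n * (1 - p)\<bar> < b * real n \<Longrightarrow> prob_zeros p n k \<ge> exp (- \<eta> * real n)"
    and n: "(1 + \<epsilon>) * exp (- (c - \<eta>) * real n) \<le> \<epsilon> / 4"
    and m: "2 * real n * (1 - p) \<le> real m"
    and u: "m \<le> u" "real u - 2 * real n * (1 - p) < b * real n" "u \<le> 2 * n"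
  shows "ell p n u - ell p n m \<ge> 3 / 4 * \<epsilon> * (real u - real m)"
  using u
proof (induction u rule: dec_induct)
  case (step k)
  let ?bad = "measure_pmf.prob (Z_law p n) (- B \<inter> {z. zeros z = k})"
  have "?bad \<le> measure_pmf.prob (Z_law p n) (- B)"
    by (intro measure_pmf.finite_measure_mono) auto
  also have "\<dots> \<le> exp (- c * real n)"
    using prob_B measure_pmf.prob_compl[of B "Z_law p n"] by (simp add: Compl_eq_Diff_UNIV)
  \<comment> \<open>The level \<open>k\<close> lies in the window: \<open>m \<le> k\<close> bounds
    it from below by \<open>2 * n * (1 - p)\<close>, and the upper bound is inherited from
    \<open>Suc k\<close>.\<close>
  finally have "?bad / prob_zeros p n k \<le> exp (- c * real n) / exp (- \<eta> * real n)"
    using step m by (intro frac_le prob_zeros) auto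
  also have "\<dots> = exp (- (c - \<eta>) * real n)"
    by (simp add: algebra_simps flip: exp_diff)
  finally have "(1 + \<epsilon>) * (?bad / prob_zeros p n k) \<le> (1 + \<epsilon>) * exp (- (c - \<eta>) * real n)"
    using \<epsilon> by (intro mult_left_mono) auto
  with n have "(1 + \<epsilon>) * (?bad / prob_zeros p n k) \<le> \<epsilon> / 4"
    by linarith
  moreover have "ell p n (Suc k) - ell p n k \<ge> \<epsilon> - (1 + \<epsilon>) * (?bad / prob_zeros p n k)"
    using step by (intro ell_Suc_diff_ge p B) auto
  moreover have "ell p n k - ell p n m \<ge> 3 / 4 * \<epsilon> * (real k - real m)"
    using step by auto
  moreover have "3 / 4 * \<epsilon> * (real (Suc k) - real m) = 3 / 4 * \<epsilon> * (real k - real m) + 3 / 4 * \<epsilon>"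
    by (simp add: field_simps)
  ultimately show ?case by linarith
qed simp

theorem theorem5p7:
  fixes p0 eps1 eps2 p q eps0 \<delta> \<eta> b :: real and c1 :: "real \<Rightarrow> real"
  assumes "Lember_Matzinger p0 eps1 eps2 c1"
    and "0 < p" and "p < 1" and "p < p0"
    and "q = 1 - p"
    and "eps0 = eps1 - eps2"
    and "\<delta> = eps0 / 2"
    and "0 < \<eta>" and "\<eta> < c1 p"
    and "0 < b"
    and "\<forall>\<^sub>F n in sequentially.
           (INF k \<in> {k :: int. \<bar>real_of_int k - 2 * real n * q\<bar> < b * real n}.
              measure_pmf.prob (Z_law p n) {z. int (zeros z) = k}) \<ge> exp (- \<eta> * real n)"
  shows "(\<exists>!t0 :: real. 0 < t0 \<and> 2 * \<delta> * t0 - b\<^sup>2 - 2 * ln (mgf q (\<delta> * t0)) = 0) \<and>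
    (\<forall>t0 :: real. 0 < t0 \<and> 2 * \<delta> * t0 - b\<^sup>2 - 2 * ln (mgf q (\<delta> * t0)) = 0 \<longrightarrow>
      (\<forall>\<epsilon> > 0. \<forall>t \<in> {0..t0}. \<exists>N. \<forall>n \<ge> N.
         measure_pmf.expectation (Z_law p n)
           (\<lambda>z. exp (t * (real (lcs z) - ell p n (nat \<lceil>2 * real n * q\<rceil>))))
         \<ge> (1 - \<epsilon>) * mgf q (\<delta> * t) ^ (2 * n)))"
proof (intro conjI allI impI ballI)
  note p = assms(2,3)
  have q: "0 < q" "q < 1" using assms(2,3,5) by auto
  have eps: "0 < eps0"
    using assms(1,6) by (simp add: Lember_Matzinger_def)
  from assms(1) obtain B where B: "\<forall>n. \<forall>z \<in> B n.
      measure_pmf.prob (Z_tilde z) {z'. int (lcs z') - int (lcs z) = 1} \<ge> eps1 \<and>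
      measure_pmf.prob (Z_tilde z) {z'. int (lcs z') - int (lcs z) = - 1} \<le> eps2"
    and LM: "\<forall>p. 0 < p \<and> p < 1 \<and> p < p0 \<longrightarrow> 0 < c1 p \<and>
      (\<forall>\<^sub>F n in sequentially. measure_pmf.prob (Z_law p n) (B n) \<ge> 1 - exp (- c1 p * real n))"
    unfolding Lember_Matzinger_def by (elim conjE exE)
  from LM assms(2-4) have prob_B:
    "\<forall>\<^sub>F n in sequentially. measure_pmf.prob (Z_law p n) (B n) \<ge> 1 - exp (- c1 p * real n)"
    by blast
  have \<delta>: "0 < \<delta>" using eps assms(7) by simp
  have eq_iff: "2 * \<delta> * t - b\<^sup>2 - 2 * ln (mgf q (\<delta> * t)) = 0 \<longleftrightarrow> \<delta> * t - ln (mgf q (\<delta> * t)) = b\<^sup>2 / 2" for t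
    by auto
  show "\<exists>!t0. 0 < t0 \<and> 2 * \<delta> * t0 - b\<^sup>2 - 2 * ln (mgf q (\<delta> * t0)) = 0"
    unfolding eq_iff using assms(10) by (intro ex1_diff_ln_mgf_eq q \<delta>) auto
  fix t0 \<epsilon> t :: real
  assume t0: "0 < t0 \<and> 2 * \<delta> * t0 - b\<^sup>2 - 2 * ln (mgf q (\<delta> * t0)) = 0" and \<epsilon>: "0 < \<epsilon>" and t: "t \<in> {0..t0}"
  define s where "s = \<delta> * t"
  show "\<exists>N. \<forall>n\<ge>N. measure_pmf.expectation (Z_law p n)
           (\<lambda>z. exp (t * (real (lcs z) - ell p n (nat \<lceil>2 * real n * q\<rceil>))))
         \<ge> (1 - \<epsilon>) * mgf q (\<delta> * t) ^ (2 * n)"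
  \<comment> \<open>At \<open>t = 0\<close> both moments equal 1; only for \<open>t > 0\<close> does
    the power of \<open>mgf q (\<delta> * t)\<close> grow and absorb constants.\<close>
  proof (cases "t = 0")
    case True
    then show ?thesis using \<epsilon> by simp
  next
    case False
    then have s: "0 < s" and t_pos: "0 < t" using t \<delta> by (auto simp: s_def)
    let ?M = "mgf q s"
    have M: "1 < ?M" by (rule mgf_gt_1[OF q s])
    \<comment> \<open>This is where \<open>t \<le> t0\<close> enters: the left side increases with
      \<open>s\<close> and attains the right side at \<open>\<delta> * t0\<close>.\<close>
    have "s - ln ?M \<le> b\<^sup>2 / 2"
    proof -
      have "s \<le> \<delta> * t0" using t \<delta> by (simp add: s_def)
      then have "s - ln ?M \<le> \<delta> * t0 - ln (mgf q (\<delta> * t0))"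
        using strict_mono_mono[OF diff_ln_mgf_strict_mono[OF q]] by (auto dest: monoD)
      then show ?thesis using t0 eq_iff[of t0] by simp
    qed
    then have tail_exponent: "2 * s - b\<^sup>2 \<le> 2 * ln ?M" by simp

    \<comment> \<open>Three eventual bounds: the first controls the slope lost outside
      \<open>B n\<close>, the other two give a share \<open>\<epsilon> / 2\<close> each to the
      levels below \<open>m + 2\<close> and to those beyond the window.\<close>
    have "\<forall>\<^sub>F n in sequentially. (1 + eps0) * exp (- (c1 p - \<eta>) * real n) \<le> eps0 / 4"
    proof -
      have "((\<lambda>n. (1 + eps0) * exp (- (c1 p - \<eta>) * real n)) \<longlongrightarrow> 0) sequentially"
        using assms(9) by real_asymp
      then show ?thesis using eps
        by (intro eventually_mono[OF order_tendstoD(2)[of _ 0 _ "eps0 / 4"] less_imp_le]) auto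
    qed
    moreover have "\<forall>\<^sub>F n in sequentially. exp (3 * s) \<le> \<epsilon> / 2 * ?M ^ (2 * n)"
    proof -
      have "filterlim (\<lambda>n. \<epsilon> / 2 * ?M ^ (2 * n)) at_top sequentially"
        using \<epsilon> M by real_asymp
      then show ?thesis by (simp add: filterlim_at_top)
    qed
    moreover have "\<forall>\<^sub>F n in sequentially. exp (- (2 * s * q) * real n) \<le> \<epsilon> / 2"
    proof -
      have "((\<lambda>n. exp (- (2 * s * q) * real n)) \<longlongrightarrow> 0) sequentially"
        using s q(1) by real_asymp
      then show ?thesis using \<epsilon>
        by (intro eventually_mono[OF order_tendstoD(2)[of _ 0 _ "\<epsilon> / 2"] less_imp_le]) auto
    qed
    ultimately have "\<forall>\<^sub>F n in sequentially. measure_pmf.expectation (Z_law p n)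
           (\<lambda>z. exp (t * (real (lcs z) - ell p n (nat \<lceil>2 * real n * q\<rceil>))))
         \<ge> (1 - \<epsilon>) * mgf q (\<delta> * t) ^ (2 * n)"
      using prob_B assms(11)
    proof eventually_elim
      case (elim n)
      define m where "m = nat \<lceil>2 * real n * q\<rceil>"
      have m: "2 * real n * (1 - p) \<le> real m" "real m \<le> 2 * real n * (1 - p) + 1"
        using q of_int_ceiling_le_add_one[of "2 * real n * q"] by (simp_all add: m_def assms(5))
      have prob_zeros_ge: "prob_zeros p n k \<ge> exp (- \<eta> * real n)"
        if "\<bar>real k - 2 * real n * (1 - p)\<bar> < b * real n" for k
      proof -
        \<comment> \<open>The infimum runs over integers, among them \<open>int k\<close>; as
          probabilities are bounded below by 0, it lies below each of its terms.\<close>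
        have "exp (- \<eta> * real n) \<le> measure_pmf.prob (Z_law p n) {z. int (zeros z) = int k}"
          using elim(5)
        proof (rule order_trans)
          show "(INF k \<in> {k :: int. \<bar>real_of_int k - 2 * real n * q\<bar> < b * real n}.
              measure_pmf.prob (Z_law p n) {z. int (zeros z) = k}) \<le> measure_pmf.prob (Z_law p n) {z. int (zeros z) = int k}"
            using that assms(5) by (intro cINF_lower bdd_belowI[of _ 0]) auto
        qed
        then show ?thesis by simp
      qed
      have step_B: "measure_pmf.expectation (Z_tilde z) (\<lambda>z'. real (lcs z')) \<ge> real (lcs z) + eps0" if "z \<in> B n" for z
        using B[rule_format, OF that] expectation_lcs_Z_tilde_ge[of z] assms(6) by linarith
      have "?M ^ (2 * n) \<le> measure_pmf.expectation (Z_law p n) (\<lambda>z. exp (t * (real (lcs z) - ell p n m)))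
          + exp (3 * s) + exp (2 * real n * s * p - b\<^sup>2 * real n)"
      proof -
        have "t * (ell p n u - ell p n m) \<ge> 3 / 2 * s * (real u - real m)"
          if "m \<le> u" "real u - 2 * real n * (1 - p) < b * real n" "u \<le> 2 * n" for u
        proof -
          \<comment> \<open>Since \<open>eps0 = 2 * \<delta>\<close>, the slope
            \<open>3 / 4 * eps0\<close> is the required \<open>3 / 2 * \<delta>\<close>.\<close>
          have "t * (ell p n u - ell p n m) \<ge> t * (3 / 4 * eps0 * (real u - real m))"
            using t_pos ell_diff_ge[OF p eps step_B elim(4) prob_zeros_ge elim(1) m(1) that]
            by (intro mult_left_mono) auto
          then show ?thesis by (simp add: s_def assms(7) mult_ac)
        qed
        from exp_moment_split[OF p t_pos s assms(10) m this] show ?thesis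
          using assms(5) by simp
      qed
      moreover have "exp (2 * real n * s * p - b\<^sup>2 * real n) \<le> \<epsilon> / 2 * ?M ^ (2 * n)"
      proof -
        \<comment> \<open>Writing \<open>p = 1 - q\<close> isolates
          \<open>2 * s - b\<^sup>2\<close>, which \<open>tail_exponent\<close> compares with
          \<open>2 * ln ?M\<close>, from a surplus that decays exponentially in
          \<open>n\<close>.\<close>
        have "2 * real n * s * p - b\<^sup>2 * real n = real n * (2 * s - b\<^sup>2) + - (2 * s * q) * real n"
          by (simp add: assms(5) algebra_simps)
        also have "\<dots> \<le> real n * (2 * ln ?M) + - (2 * s * q) * real n"
          using tail_exponent by (intro add_right_mono mult_left_mono) auto
        finally have "exp (2 * real n * s * p - b\<^sup>2 * real n) \<le> exp (real n * (2 * ln ?M)) * exp (- (2 * s * q) * real n)"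
          by (simp flip: exp_add)
        also have "exp (real n * (2 * ln ?M)) = ?M ^ (2 * n)"
          using M by (simp add: exp_of_nat_mult power_mult exp_double power2_eq_square mult.commute[of _ 2])
        also have "?M ^ (2 * n) * exp (- (2 * s * q) * real n) \<le> ?M ^ (2 * n) * (\<epsilon> / 2)"
          using elim(3) M by (intro mult_left_mono) auto
        finally show ?thesis by (simp add: mult.commute)
      qed
      ultimately show ?case
        using elim(2) by (simp add: m_def s_def algebra_simps)
    qed
    then show ?thesis by (simp add: eventually_sequentially)
  qed
qed

end
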